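(* Let $n,m\ge 1$, let $a,b\in P_n$ and let $k_1,\dots,k_m\in[0,\infty)$. Then $$\sum_{i=1}^n a_i\log\prod_{s=1}^m\left(\frac{a_i}{b_i}+k_s\right)\ \ge\ \log\prod_{s=1}^m(1+k_s).$$
   Context: $P_n=\{p=(p_1,\dots,p_n)\in\mathbb{R}^n : p_i>0 \text{ for all } i,\ \sum_{i=1}^n p_i=1\}$. $\log$ is the natural logarithm. *)

theory Defs
  imports "HOL-Analysis.Analysis"
begin

(* The set P_n of strictly positive probability vectors in R^n, with n = CARD('n). *)
definition pos_prob_vecs :: "(real ^ 'n) set" where
  "pos_prob_vecs = {p. (\<forall>i. 0 < p $ i) \<and> (\<Sum>i\<in>UNIV. p $ i) = 1}"

end

(* Each factor is treated separately: x * ln (x + k) is convex in x, so it lies above its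
   tangent at x = 1. At x = a_i / b_i, weighted by b_i, the linear terms sum to a multiple of
   the sum of a_i - b_i, which is zero. *)
theory Submission
  imports Defs
begin

text \<open>The tangent to \<open>x * ln (x + k)\<close> at 1 is
  \<open>x * ln (1 + k) + (x - 1) / (1 + k)\<close>; its first term is moved to the other side here.
  No derivatives are needed: \<open>ln y \<le> y - 1\<close> gives a bound with denominator
  \<open>x + k\<close>, which is then compared with the one with \<open>1 + k\<close>.\<close>

lemma mult_ln_add_ge_tangent:
  fixes x k :: real
  assumes "x > 0" "k \<ge> 0"
  shows "x * (ln (x + k) - ln (1 + k)) \<ge> (x - 1) / (1 + k)"
proof -
  \<comment> \<open>The two linear bounds agree at \<open>x = 1\<close> to second order, so their
    difference is a nonnegative multiple of a square, whatever the sign of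
    \<open>x - 1\<close>.\<close>
  have "x * (x - 1) / (x + k) - (x - 1) / (1 + k) = k * (x - 1)\<^sup>2 / ((x + k) * (1 + k))"
    using assms by (simp add: divide_simps) (simp add: power2_eq_square algebra_simps)
  also have "\<dots> \<ge> 0"
    using assms by simp
  finally have "(x - 1) / (1 + k) \<le> x * ((x - 1) / (x + k))"
    by simp
  also have "\<dots> \<le> x * (ln (x + k) - ln (1 + k))"
  proof (rule mult_left_mono)
    \<comment> \<open>Taking the reciprocal ratio turns the upper bound on \<open>ln\<close> into a
      lower bound on \<open>ln (x + k) - ln (1 + k)\<close>.\<close>
    have "ln ((1 + k) / (x + k)) \<le> (1 + k) / (x + k) - 1"
      using assms by (intro ln_le_minus_one) simp
    also have "\<dots> = - ((x - 1) / (x + k))"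
      using assms by (simp add: divide_simps)
    finally show "(x - 1) / (x + k) \<le> ln (x + k) - ln (1 + k)"
      using assms by (simp add: ln_div)
  qed (use assms in simp)
  finally show ?thesis .
qed

lemma sum_mult_ln_ratio_add_ge:
  fixes a b :: "real ^ 'n" and k :: real
  assumes "a \<in> pos_prob_vecs" "b \<in> pos_prob_vecs" "k \<ge> 0"
  shows "(\<Sum>i\<in>UNIV. a $ i * ln (a $ i / b $ i + k)) \<ge> ln (1 + k)"
proof -
  have pos: "a $ i > 0" "b $ i > 0" for i
    using assms by (auto simp: pos_prob_vecs_def)
  have sums: "(\<Sum>i\<in>UNIV. a $ i) = 1" "(\<Sum>i\<in>UNIV. b $ i) = 1"
    using assms by (auto simp: pos_prob_vecs_def)
  have "(a $ i - b $ i) / (1 + k) \<le> a $ i * (ln (a $ i / b $ i + k) - ln (1 + k))" for i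
  proof -
    have "b $ i * ((a $ i / b $ i - 1) / (1 + k))
        \<le> b $ i * (a $ i / b $ i * (ln (a $ i / b $ i + k) - ln (1 + k)))"
      using pos[of i] assms(3) by (intro mult_left_mono mult_ln_add_ge_tangent) auto
    moreover have "b $ i * ((a $ i / b $ i - 1) / (1 + k)) = (a $ i - b $ i) / (1 + k)"
      using pos(2)[of i] by (simp add: right_diff_distrib)
    moreover have "b $ i * (a $ i / b $ i * (ln (a $ i / b $ i + k) - ln (1 + k)))
        = a $ i * (ln (a $ i / b $ i + k) - ln (1 + k))"
      using pos(2)[of i] by simp
    ultimately show ?thesis
      by argo
  qed
  then have "(\<Sum>i\<in>UNIV. (a $ i - b $ i) / (1 + k))
      \<le> (\<Sum>i\<in>UNIV. a $ i * (ln (a $ i / b $ i + k) - ln (1 + k)))"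
    by (intro sum_mono)
  moreover have "(\<Sum>i\<in>UNIV. (a $ i - b $ i) / (1 + k)) = 0"
    using sums by (simp flip: sum_divide_distrib add: sum_subtractf)
  \<comment> \<open>The constant \<open>ln (1 + k)\<close> has total weight 1, as the entries of
    \<open>a\<close> sum to 1.\<close>
  moreover have "(\<Sum>i\<in>UNIV. a $ i * (ln (a $ i / b $ i + k) - ln (1 + k)))
      = (\<Sum>i\<in>UNIV. a $ i * ln (a $ i / b $ i + k)) - ln (1 + k)"
    using sums by (simp add: right_diff_distrib sum_subtractf flip: sum_distrib_right)
  ultimately show ?thesis
    by linarith
qed

theorem corollary5p7:
  fixes a b :: "real ^ 'n" and k :: "real ^ 'm"
  assumes "a \<in> pos_prob_vecs" and "b \<in> pos_prob_vecs"
    and "\<And>s. k $ s \<in> {0..}"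
  shows "(\<Sum>i\<in>UNIV. a $ i * ln (\<Prod>s\<in>UNIV. (a $ i / b $ i + k $ s)))
           \<ge> ln (\<Prod>s\<in>UNIV. (1 + k $ s))"
proof -
  have k: "k $ s \<ge> 0" for s
    using assms(3) by simp
  have pos: "a $ i / b $ i + k $ s > 0" for i s
    using assms(1,2) k[of s] by (auto simp: pos_prob_vecs_def intro!: add_pos_nonneg)
  have "ln (\<Prod>s\<in>UNIV. (1 + k $ s)) = (\<Sum>s\<in>UNIV. ln (1 + k $ s))"
    using add_pos_nonneg[OF zero_less_one k, THEN less_imp_neq] by (intro ln_prod) auto
  \<comment> \<open>With the logarithm of the product split into a sum over \<open>s\<close>, the
    single-factor bound applies to each \<open>k $ s\<close> on its own; swapping the sums then
    reassembles the product for each \<open>i\<close>.\<close>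
  also have "\<dots> \<le> (\<Sum>s\<in>UNIV. \<Sum>i\<in>UNIV. a $ i * ln (a $ i / b $ i + k $ s))"
    using assms(1,2) k by (intro sum_mono sum_mult_ln_ratio_add_ge)
  also have "\<dots> = (\<Sum>i\<in>UNIV. a $ i * (\<Sum>s\<in>UNIV. ln (a $ i / b $ i + k $ s)))"
    by (subst sum.swap) (simp add: sum_distrib_left)
  also have "\<dots> = (\<Sum>i\<in>UNIV. a $ i * ln (\<Prod>s\<in>UNIV. (a $ i / b $ i + k $ s)))"
    using pos[THEN less_imp_neq] by (intro sum.cong refl arg_cong2[where f = times] ln_prod[symmetric]) auto
  finally show ?thesis .
qed

end
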